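(* For every integer $n\ge 0$, as an identity of polynomials in the variable $t$ with rational coefficients, $$\sum_{k=0}^{n}\boldsymbol{l}(n,k)\,t^{k}=\frac{1}{n!}\sum_{k=0}^{n}\sum_{j=0}^{n-k}(-1)^{j}\binom{n}{k}\binom{n-k}{j}\binom{k}{j}\frac{j!\,(n-j)!}{n-j+1}\,t^{\,n-k}.$$
   Context: The Leibnitz numbers are defined for integers $n\ge 0$ and $0\le k\le n$ by $\boldsymbol{l}(n,k)=\dfrac{1}{(n+1)\binom{n}{k}}$. The binomial coefficient $\binom{k}{j}$ is $0$ when $j>k$. *)

theory Defs
  imports "HOL-Computational_Algebra.Polynomial"
begin

text \<open>The Leibnitz numbers; only the values with \<open>k \<le> n\<close> are meaningful
  (for \<open>k > n\<close> the division by zero gives \<open>0\<close>).\<close>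

definition leibnitz :: "nat \<Rightarrow> nat \<Rightarrow> rat" where
  "leibnitz n k = 1 / (of_nat (n + 1) * of_nat (n choose k))"

end

theory Submission
  imports Defs
begin

text \<open>Put \<open>m = n - k\<close>. The coefficient of \<open>t\<^sup>m\<close> on the right is the alternating sum
  \<open>\<Sum>j. (-1)\<^sup>j (m choose j) (n - j choose m) / (n - j + 1)\<close>, an \<open>m\<close>-th difference. For
  \<open>a \<le> m\<close> replace \<open>(n - j choose m)\<close> by \<open>(n - j choose a)\<close>. Pascal's rule and
  \<open>(N + 1 choose a + 1) / (N + 1) = (N choose a) / (a + 1)\<close> show that passing from \<open>a\<close> to \<open>a + 1\<close>
  only changes the sign, up to the \<open>m\<close>-th difference of a polynomial of degree \<open>a < m\<close>,
  which vanishes. This reduces the claim to \<open>a = 0\<close>, the partial fraction expansion of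
  \<open>m! / ((n + 1) n \<dots> (n + 1 - m))\<close>.\<close>

definition alt_sum :: "nat \<Rightarrow> (nat \<Rightarrow> 'a) \<Rightarrow> 'a::field_char_0" where
  "alt_sum m f = (\<Sum>j\<le>m. (-1) ^ j * of_nat (m choose j) * f j)"

lemma alt_sum_cong: "(\<And>j. j \<le> m \<Longrightarrow> f j = g j) \<Longrightarrow> alt_sum m f = alt_sum m g"
  by (simp add: alt_sum_def)

lemma alt_sum_diff: "alt_sum m (\<lambda>j. f j - g j) = alt_sum m f - alt_sum m g"
  by (simp add: alt_sum_def sum_subtractf algebra_simps)

lemma alt_sum_cmult: "alt_sum m (\<lambda>j. c * f j) = c * alt_sum m f"
  by (simp add: alt_sum_def sum_distrib_left algebra_simps)

text \<open>Pascal's rule for \<open>Suc m choose j\<close> splits the sum in two. Inductions on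
  \<open>m\<close> can then peel off one difference at a time.\<close>

lemma alt_sum_Suc: "alt_sum (Suc m) f = alt_sum m f - alt_sum m (\<lambda>j. f (Suc j))"
proof -
  have "alt_sum (Suc m) f =
      f 0 + (\<Sum>j\<le>m. (-1) ^ Suc j * of_nat (m choose Suc j) * f (Suc j))
      - alt_sum m (\<lambda>j. f (Suc j))"
    unfolding alt_sum_def
    by (subst sum.atMost_Suc_shift)
       (simp add: algebra_simps sum.distrib sum_negf sum_subtractf)
  \<comment> \<open>The added top term \<open>j = Suc m\<close> is zero, since
    \<open>m choose Suc m = 0\<close>.\<close>
  moreover have "f 0 + (\<Sum>j\<le>m. (-1) ^ Suc j * of_nat (m choose Suc j) * f (Suc j)) =
      (\<Sum>j\<le>Suc m. (-1) ^ j * of_nat (m choose j) * f j)"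
    by (subst sum.atMost_Suc_shift) simp
  moreover have "\<dots> = alt_sum m f"
    by (simp add: alt_sum_def binomial_eq_0)
  ultimately show ?thesis by simp
qed

text \<open>By Pascal's rule each difference lowers \<open>a\<close> by one, so a constant is
  reached while a difference is still left to take. The bound \<open>m \<le> n\<close> keeps every
  \<open>n - j\<close> untruncated.\<close>

lemma alt_sum_binomial_eq_0:
  assumes "a < m" "m \<le> n"
  shows "alt_sum m (\<lambda>j. of_nat (n - j choose a)) = (0 :: 'a::field_char_0)"
  using assms
proof (induction a arbitrary: m n)
  case 0
  then obtain m' where "m = Suc m'" by (cases m) auto
  then show ?case by (simp add: alt_sum_Suc)
next
  case (Suc a)
  then obtain m' n' where [simp]: "m = Suc m'" "n = Suc n'"
    by (metis Suc_le_D Suc_lessE)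
  have "alt_sum m (\<lambda>j. of_nat (n - j choose Suc a) :: 'a)
      = alt_sum m' (\<lambda>j. of_nat (n - j choose Suc a) - of_nat (n' - j choose Suc a))"
    by (simp add: alt_sum_Suc alt_sum_diff)
  also have "\<dots> = alt_sum m' (\<lambda>j. of_nat (n' - j choose a))"
    using Suc.prems by (intro alt_sum_cong) (simp add: Suc_diff_le)
  also have "\<dots> = 0"
    using Suc by simp
  finally show ?case .
qed

lemma alt_sum_inverse:
  assumes "m \<le> n"
  shows "alt_sum m (\<lambda>j. 1 / of_nat (n - j + 1)) =
    ((-1) ^ m * fact m * fact (n - m) / fact (n + 1) :: 'a::field_char_0)"
  using assms
proof (induction m arbitrary: n)
  case 0
  then show ?case by (simp add: alt_sum_def divide_simps)
next
  case (Suc m)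
  then obtain d where n: "n = Suc (m + d)"
    by (metis add_Suc le_Suc_ex)
  have "alt_sum (Suc m) (\<lambda>j. 1 / of_nat (n - j + 1)) =
      ((-1) ^ m * fact m * fact (Suc d) / fact (m + d + 2)
       - (-1) ^ m * fact m * fact d / fact (m + d + 1) :: 'a)"
    \<comment> \<open>Shifting \<open>j\<close> by one replaces \<open>n\<close> by
      \<open>n - 1 = m + d\<close>, which is why the induction leaves \<open>n\<close>
      arbitrary.\<close>
    using Suc.IH[of n] Suc.IH[of "m + d"] by (simp add: alt_sum_Suc n)
  also have "\<dots> = (-1) ^ m * fact m * fact d * (of_nat (Suc d) - of_nat (m + d + 2)) / fact (m + d + 2)"
  proof -
    have "fact (m + d + 2) = (of_nat (m + d + 2) * fact (m + d + 1) :: 'a)"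
      by simp
    moreover have "of_nat (m + d + 2) \<noteq> (0 :: 'a)"
      by (metis of_nat_eq_0_iff add_is_0 zero_neq_numeral)
    ultimately show ?thesis
      by (simp add: field_simps del: of_nat_add of_nat_Suc fact_Suc) (simp add: algebra_simps)
  qed
  also have "of_nat (Suc d) - of_nat (m + d + 2) = (- of_nat (Suc m) :: 'a)"
    by simp
  finally show ?case by (simp add: n algebra_simps)
qed

lemma alt_sum_binomial_divide:
  assumes "a \<le> m" "m \<le> n"
  shows "alt_sum m (\<lambda>j. of_nat (n - j choose a) / of_nat (n - j + 1)) =
    ((-1) ^ (m + a) * fact m * fact (n - m) / fact (n + 1) :: 'a::field_char_0)"
  using assms(1)
proof (induction a)
  case 0
  then show ?case using alt_sum_inverse[OF assms(2)] by simp
next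
  case (Suc a)
  \<comment> \<open>This is the absorption identity
    \<open>(a + 1) (N + 1 choose a + 1) = (N + 1) (N choose a)\<close>, expanded by Pascal's rule
    and divided by \<open>(a + 1) (N + 1)\<close>.\<close>
  have step: "of_nat (N choose Suc a) / of_nat (N + 1) =
      (1 / of_nat (Suc a) * of_nat (N choose a) - of_nat (N choose a) / of_nat (N + 1) :: 'a)" for N
  proof -
    have "of_nat (Suc a * (Suc N choose Suc a)) = (of_nat (Suc N * (N choose a)) :: 'a)"
      by (metis Suc_times_binomial)
    then have "of_nat (Suc a) * (of_nat (N choose a) + of_nat (N choose Suc a)) =
        (of_nat (N + 1) * of_nat (N choose a) :: 'a)"
      by (simp only: binomial_Suc_Suc of_nat_mult flip: of_nat_add Suc_eq_plus1)
    moreover have "of_nat (Suc a) \<noteq> (0 :: 'a)" "of_nat (N + 1) \<noteq> (0 :: 'a)"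
      by (simp_all del: of_nat_Suc of_nat_add)
    ultimately show ?thesis
      by (simp add: field_simps del: of_nat_Suc of_nat_add)
  qed
  have "alt_sum m (\<lambda>j. of_nat (n - j choose a)) = (0 :: 'a)"
    using Suc.prems assms(2) by (intro alt_sum_binomial_eq_0) auto
  then have "alt_sum m (\<lambda>j. of_nat (n - j choose Suc a) / of_nat (n - j + 1)) =
      - alt_sum m (\<lambda>j. of_nat (n - j choose a) / of_nat (n - j + 1) :: 'a)"
    unfolding step alt_sum_diff alt_sum_cmult by simp
  then show ?case
    using Suc by simp
qed

text \<open>In factorials, \<open>k!\<close> and \<open>j!\<close> cancel on the left, and
  \<open>(m + k - j)! / (m! (k - j)!)\<close> is the remaining binomial coefficient.\<close>

lemma binomial_product_fact:
  assumes "j \<le> m"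
  shows "of_nat (m + k choose k) * of_nat (m choose j) * of_nat (k choose j) * (fact j * fact (m + k - j))
    = (fact (m + k) * (of_nat (m choose j) * of_nat (m + k - j choose m)) :: 'a::field_char_0)"
proof (cases "j \<le> k")
  case True
  then have "m \<le> m + k - j" "m + k - j - m = k - j" by auto
  with True assms show ?thesis
    by (simp add: binomial_fact)
next
  \<comment> \<open>Both sides vanish: \<open>k choose j = 0\<close> on the left, and
    \<open>m + k - j < m\<close> on the right.\<close>
  case False
  then show ?thesis using assms by (simp add: binomial_eq_0)
qed

lemma leibnitz_coeff:
  assumes "k \<le> n"
  shows "leibnitz n (n - k) = 1 / fact n *
    (\<Sum>j=0..n - k. (-1) ^ j * of_nat (n choose k) * of_nat ((n - k) choose j) * of_nat (k choose j)
       * (fact j * fact (n - j) / of_nat (n - j + 1)))"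
proof -
  define m where "m = n - k"
  have n: "n = m + k" using assms by (simp add: m_def)
  have "(\<Sum>j=0..m. (-1) ^ j * of_nat (n choose k) * of_nat (m choose j) * of_nat (k choose j)
       * (fact j * fact (n - j) / of_nat (n - j + 1)))
    = fact n * alt_sum m (\<lambda>j. of_nat (n - j choose m) / of_nat (n - j + 1) :: rat)"
    unfolding alt_sum_def sum_distrib_left atLeast0AtMost
  proof (intro sum.cong refl)
    fix j assume "j \<in> {..m}"
    then show "(-1) ^ j * of_nat (n choose k) * of_nat (m choose j) * of_nat (k choose j)
       * (fact j * fact (n - j) / of_nat (n - j + 1))
      = fact n * ((-1) ^ j * of_nat (m choose j) * (of_nat (n - j choose m) / of_nat (n - j + 1) :: rat))"
      using arg_cong[OF binomial_product_fact[of j m k, where 'a = rat],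
          of "\<lambda>x. (-1) ^ j * x / of_nat (n - j + 1)"]
      by (simp add: n mult_ac)
  qed
  \<comment> \<open>At \<open>a = m\<close> the sign is \<open>(-1) ^ (m + m) = 1\<close>.\<close>
  also have "\<dots> = fact n * (fact m * fact k / fact (n + 1))"
    by (subst alt_sum_binomial_divide) (simp_all add: n)
  also have "fact m * fact k / fact (n + 1) = leibnitz n m"
    by (simp add: leibnitz_def n binomial_fact)
  finally show ?thesis
    unfolding m_def by simp
qed

theorem theorem5p2:
  fixes n :: nat
  shows "(\<Sum>k=0..n. monom (leibnitz n k) k) =
    smult (1 / fact n)
      (\<Sum>k=0..n. \<Sum>j=0..n - k.
        monom ((-1) ^ j * of_nat (n choose k) * of_nat ((n - k) choose j) * of_nat (k choose j)
                 * (fact j * fact (n - j) / of_nat (n - j + 1)))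
              (n - k))"
proof -
  \<comment> \<open>Reversing the order gives both sides the exponent \<open>n - k\<close>, so they
    can be compared term by term.\<close>
  have "(\<Sum>k=0..n. monom (leibnitz n k) k) = (\<Sum>k=0..n. monom (leibnitz n (n - k)) (n - k))"
    by (subst sum.atLeastAtMost_rev) simp
  also have "\<dots> = (\<Sum>k=0..n. smult (1 / fact n) (\<Sum>j=0..n - k.
        monom ((-1) ^ j * of_nat (n choose k) * of_nat ((n - k) choose j) * of_nat (k choose j)
                 * (fact j * fact (n - j) / of_nat (n - j + 1)))
              (n - k)))"
    by (intro sum.cong refl, subst leibnitz_coeff)
       (simp_all only: atLeastAtMost_iff monom_sum flip: smult_monom)
  finally show ?thesis by (simp add: poly_eq_iff coeff_sum sum_distrib_left)
qed

end
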